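(* There is a linear order $\prec$ on $\mathbb{N}$ such that $\mathrm{FO}(<,\prec)$ has the same expressive power as $\mathrm{FO}(\mathrm{Bit})$ on the class of all finite structures.
   Context: Built-in predicates: a $k$-ary numerical predicate $P\subseteq\mathbb{N}^k$ is interpreted on a finite structure with universe $[n]=\{0,\dots,n\}$ as $P^n=P\cap[n]^k$. For a list $\ell$ of such predicates, $\mathrm{FO}(\ell)$ is first-order logic over finite structures with universe $[n]$ (arbitrary $n$, arbitrary finite relational signature) that may additionally use symbols for the predicates in $\ell$, interpreted as $P^n$. Two such logics have the same expressive power if every formula of either is equivalent, on all finite structures, to a formula of the other. $<$ is the usual order on $\mathbb{N}$ and $\mathrm{Bit}=\{(a,i)\in\mathbb{N}^2 : 2\nmid\lfloor a/2^i\rfloor\}$. *)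

theory Defs
  imports Main
begin

(* First-order formulas over a relational signature with relation symbols 'r
   (a symbol is applied to a list of variables; its interpretation is a set of
   tuples = lists) and built-in numerical predicate symbols 'p. Variables are nat. *)
datatype ('r, 'p) fo =
    Rel 'r "nat list"
  | Num 'p "nat list"
  | Eq nat nat
  | Neg "('r, 'p) fo"
  | Conj "('r, 'p) fo" "('r, 'p) fo"
  | Ex nat "('r, 'p) fo"

definition is_structure :: "nat \<Rightarrow> ('r \<Rightarrow> nat list set) \<Rightarrow> bool" where
  "is_structure n I \<longleftrightarrow> (\<forall>R. \<forall>t\<in>I R. set t \<subseteq> {0..n})"

fun sat :: "('p \<Rightarrow> nat list set) \<Rightarrow> nat \<Rightarrow> ('r \<Rightarrow> nat list set) \<Rightarrow> (nat \<Rightarrow> nat)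
            \<Rightarrow> ('r, 'p) fo \<Rightarrow> bool" where
  "sat N n I s (Rel R xs) = (map s xs \<in> I R)"
| "sat N n I s (Num P xs) = (map s xs \<in> N P \<and> set (map s xs) \<subseteq> {0..n})"
| "sat N n I s (Eq x y) = (s x = s y)"
| "sat N n I s (Neg \<phi>) = (\<not> sat N n I s \<phi>)"
| "sat N n I s (Conj \<phi> \<psi>) = (sat N n I s \<phi> \<and> sat N n I s \<psi>)"
| "sat N n I s (Ex x \<phi>) = (\<exists>a\<in>{0..n}. sat N n I (s(x := a)) \<phi>)"

definition fo_equiv ::
  "('p \<Rightarrow> nat list set) \<Rightarrow> ('r, 'p) fo \<Rightarrow> ('q \<Rightarrow> nat list set) \<Rightarrow> ('r, 'q) fo \<Rightarrow> bool" where
  "fo_equiv N1 \<phi> N2 \<psi> \<longleftrightarrow>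
     (\<forall>n I s. is_structure n I \<longrightarrow> (\<forall>x. s x \<le> n) \<longrightarrow> (sat N1 n I s \<phi> \<longleftrightarrow> sat N2 n I s \<psi>))"

(* Same expressive power. The relation-symbol type is fixed to nat, so every finite
   relational signature (indeed any countable one) is covered. *)
definition same_expressive_power :: "('p \<Rightarrow> nat list set) \<Rightarrow> ('q \<Rightarrow> nat list set) \<Rightarrow> bool" where
  "same_expressive_power N1 N2 \<longleftrightarrow>
     (\<forall>\<phi> :: (nat, 'p) fo. \<exists>\<psi> :: (nat, 'q) fo. fo_equiv N1 \<phi> N2 \<psi>) \<and>
     (\<forall>\<psi> :: (nat, 'q) fo. \<exists>\<phi> :: (nat, 'p) fo. fo_equiv N1 \<phi> N2 \<psi>)"

definition Bit :: "nat list set" where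
  "Bit = {[a, i] | a i. odd (a div 2 ^ i)}"

definition less_pred :: "nat list set" where
  "less_pred = {[a, b] | a b. a < b}"

definition rel_pred :: "(nat \<times> nat) set \<Rightarrow> nat list set" where
  "rel_pred r = {[a, b] | a b. (a, b) \<in> r}"

definition less_and :: "(nat \<times> nat) set \<Rightarrow> bool \<Rightarrow> nat list set" where
  "less_and r = (\<lambda>b. if b then less_pred else rel_pred r)"

end

theory Submission
  imports Defs "HOL-Library.Nat_Bijection"
begin

text \<open>
  Order the even numbers by their lowest differing bit (the order of the reversed binary
  expansions), and let the odd numbers follow them. Comparing \<open>x\<close> with \<open>x - 1\<close> reveals the parity
  of \<open>x\<close>; an even number \<open>p\<close> is a power of two iff it precedes all smaller positive even numbers;
  and \<open>x\<close> modulo a power of two \<open>p\<close> is the last even number below \<open>p\<close> in the reversed order that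
  does not come after \<open>x\<close>. So the two orders define the bit of \<open>x\<close> at a power of two, and it
  remains to define the map from \<open>i\<close> to \<open>2 ^ i\<close>. This is encoded in the odd numbers: they keep
  their usual order, except that \<open>2 ^ i - 1\<close> is moved to the place of \<open>i\<close>.

  Conversely, the new order is definable from Bit and \<open><\<close>, so \<open><\<close> has to be defined from Bit
  alone. If \<open><\<close> is definable on the numbers below \<open>k\<close>, comparing top differing bits defines it
  below \<open>2 ^ k\<close>. Three such lifts reach \<open>n\<close> from about \<open>log (log n)\<close>, and below that bound the
  whole order is coded by a single element, a set of initial segments.
\<close>

section \<open>Definable predicates\<close>

primrec rename :: "(nat \<Rightarrow> nat) \<Rightarrow> ('r, 'p) fo \<Rightarrow> ('r, 'p) fo" where
  "rename f (Rel R xs) = Rel R (map f xs)"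
| "rename f (Num P xs) = Num P (map f xs)"
| "rename f (Eq x y) = Eq (f x) (f y)"
| "rename f (Neg \<phi>) = Neg (rename f \<phi>)"
| "rename f (Conj \<phi> \<psi>) = Conj (rename f \<phi>) (rename f \<psi>)"
| "rename f (Ex x \<phi>) = Ex (f x) (rename f \<phi>)"

text \<open>Injectivity keeps the bound variable \<open>f x\<close> apart from the images of the
  other variables.\<close>

lemma sat_rename:
  assumes "inj f"
  shows "sat N n I s (rename f \<phi>) \<longleftrightarrow> sat N n I (s \<circ> f) \<phi>"
proof (induction \<phi> arbitrary: s)
  case (Ex x \<phi>)
  have "s(f x := a) \<circ> f = (s \<circ> f)(x := a)" for a
    using assms by (auto simp: fun_eq_iff inj_eq)
  then show ?case by (simp only: rename.simps sat.simps Ex.IH)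
qed (auto simp: comp_def)

text \<open>Supplies the fresh variable for the quantifier in \<open>definable_ex\<close>.\<close>

lemma sat_finitely_many_variables:
  "\<exists>k. \<forall>n I s s'. (\<forall>x<k. s x = s' x) \<longrightarrow> (sat N n I s \<phi> \<longleftrightarrow> sat N n I s' \<phi>)"
proof (induction \<phi>)
  case (Rel R xs)
  \<comment> \<open>The sum of the list bounds each of its entries.\<close>
  have "map s xs = map s' xs" if "\<forall>x<Suc (sum_list xs). s x = s' x" for s s' :: "nat \<Rightarrow> nat"
    using that member_le_sum_list[of _ xs] by (auto simp: less_Suc_eq_le)
  then show ?case by (intro exI[of _ "Suc (sum_list xs)"]) (simp only: sat.simps, metis)
next
  case (Num P xs)
  have "map s xs = map s' xs" if "\<forall>x<Suc (sum_list xs). s x = s' x" for s s' :: "nat \<Rightarrow> nat"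
    using that member_le_sum_list[of _ xs] by (auto simp: less_Suc_eq_le)
  then show ?case by (intro exI[of _ "Suc (sum_list xs)"]) (simp only: sat.simps, metis)
next
  case (Eq x y)
  show ?case by (rule exI[of _ "Suc (x + y)"]) auto
next
  case (Neg \<phi>)
  then show ?case by simp
next
  case (Conj \<phi> \<psi>)
  then obtain k l where
    k: "\<And>n I s s'. \<forall>x<k. s x = s' x \<Longrightarrow> sat N n I s \<phi> \<longleftrightarrow> sat N n I s' \<phi>" and
    l: "\<And>n I s s'. \<forall>x<l. s x = s' x \<Longrightarrow> sat N n I s \<psi> \<longleftrightarrow> sat N n I s' \<psi>"
    by blast
  have "sat N n I s (Conj \<phi> \<psi>) \<longleftrightarrow> sat N n I s' (Conj \<phi> \<psi>)" if "\<forall>x<max k l. s x = s' x" for n I s s'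
    using k[of s s' n I] l[of s s' n I] that by simp
  then show ?case by blast
next
  case (Ex x \<phi>)
  then obtain k where
    k: "\<And>n I s s'. (\<forall>x<k. s x = s' x) \<Longrightarrow> (sat N n I s \<phi> \<longleftrightarrow> sat N n I s' \<phi>)"
    by blast
  have "sat N n I (s(x := a)) \<phi> \<longleftrightarrow> sat N n I (s'(x := a)) \<phi>" if "\<forall>y<k. s y = s' y" for n I s s' a
    by (rule k) (use that in simp)
  then have "sat N n I s (Ex x \<phi>) \<longleftrightarrow> sat N n I s' (Ex x \<phi>)" if "\<forall>y<k. s y = s' y" for n I s s'
    unfolding sat.simps using that by meson
  then show ?case by blast
qed

text \<open>\<open>P\<close> sees the universe and the assignment but not the interpretation
  \<open>I\<close>, as befits a numerical predicate.\<close>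

definition definable :: "('p \<Rightarrow> nat list set) \<Rightarrow> (nat \<Rightarrow> (nat \<Rightarrow> nat) \<Rightarrow> bool) \<Rightarrow> bool" where
  "definable N P \<longleftrightarrow> (\<exists>\<phi> :: (nat, 'p) fo. \<forall>n I s. (\<forall>x. s x \<le> n) \<longrightarrow> (sat N n I s \<phi> \<longleftrightarrow> P n s))"

lemma definable_eq: "definable N (\<lambda>n e. e x = e y)"
  unfolding definable_def by (rule exI[of _ "Eq x y"]) simp

lemma definable_Num: "definable N (\<lambda>n e. map e xs \<in> N P)"
  unfolding definable_def by (rule exI[of _ "Num P xs"]) auto

lemma definable_not: "definable N P \<Longrightarrow> definable N (\<lambda>n e. \<not> P n e)"
  unfolding definable_def by (elim exE, rule_tac x = "Neg \<phi>" in exI) simp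

lemma definable_conj:
  "definable N P \<Longrightarrow> definable N Q \<Longrightarrow> definable N (\<lambda>n e. P n e \<and> Q n e)"
  unfolding definable_def by (elim exE, rule_tac x = "Conj \<phi> \<phi>'" in exI) simp

lemma definable_disj:
  assumes "definable N P" "definable N Q"
  shows "definable N (\<lambda>n e. P n e \<or> Q n e)"
  using definable_not[OF definable_conj[OF assms[THEN definable_not]]] by simp

lemma definable_imp:
  assumes "definable N P" "definable N Q"
  shows "definable N (\<lambda>n e. P n e \<longrightarrow> Q n e)"
  unfolding imp_conv_disj by (intro definable_disj definable_not assms)

lemma definable_iff:
  assumes "definable N P" "definable N Q"
  shows "definable N (\<lambda>n e. P n e \<longleftrightarrow> Q n e)"
  unfolding iff_conv_conj_imp by (intro definable_conj definable_imp assms)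

lemma definable_False: "definable N (\<lambda>n e. False)"
  using definable_not[OF definable_eq[of N 0 0]] by simp

text \<open>The premise describes the body of the quantifier in de Bruijn style: the witness becomes
  variable 0 and the other variables are shifted. Hence no freshness conditions arise.\<close>

lemma definable_ex:
  fixes N :: "'p \<Rightarrow> nat list set"
  assumes "definable N (\<lambda>n e. P n (\<lambda>i. e (Suc i)) (e 0))"
  shows "definable N (\<lambda>n e. \<exists>a\<le>n. P n e a)"
proof -
  obtain \<phi> :: "(nat, 'p) fo" where
    \<phi>: "\<And>n I s. \<forall>x. s x \<le> n \<Longrightarrow> sat N n I s \<phi> \<longleftrightarrow> P n (\<lambda>i. s (Suc i)) (s 0)"
    using assms unfolding definable_def by blast
  obtain k where k: "\<And>n I s s'. \<forall>x<k. s x = s' x \<Longrightarrow> sat N n I s \<phi> \<longleftrightarrow> sat N n I s' \<phi>"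
    using sat_finitely_many_variables[of N \<phi>] by blast
  \<comment> \<open>The witness moves to \<open>k\<close>. Outer variables return from
    \<open>Suc v\<close> to \<open>v\<close> below \<open>k\<close>, which covers all those that the
    body depends on; from \<open>k\<close> on they stay shifted to keep \<open>f\<close>
    injective.\<close>
  define f where "f x = (case x of 0 \<Rightarrow> k | Suc v \<Rightarrow> if v < k then v else Suc v)" for x
  have "inj f"
    by (rule injI) (auto simp: f_def split: nat.splits if_splits)
  have "sat N n I s (Ex k (rename f \<phi>)) \<longleftrightarrow> (\<exists>a\<le>n. P n s a)" if s: "\<forall>x. s x \<le> n" for n I s
  proof -
    have "sat N n I (s(k := a)) (rename f \<phi>) \<longleftrightarrow> P n s a" if "a \<le> n" for a
    proof -
      have "sat N n I (s(k := a)) (rename f \<phi>) \<longleftrightarrow> sat N n I (s(k := a) \<circ> f) \<phi>"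
        by (rule sat_rename) fact
      also have "\<dots> \<longleftrightarrow> sat N n I (case_nat a s) \<phi>"
        by (rule k) (auto simp: f_def split: nat.splits)
      also have "\<dots> \<longleftrightarrow> P n s a"
        using s that by (subst \<phi>) (auto split: nat.splits)
      finally show ?thesis .
    qed
    then show ?thesis by auto
  qed
  then show ?thesis unfolding definable_def by blast
qed

lemma definable_all:
  assumes "definable N (\<lambda>n e. P n (\<lambda>i. e (Suc i)) (e 0))"
  shows "definable N (\<lambda>n e. \<forall>a\<le>n. P n e a)"
  using definable_not[OF definable_ex[where P = "\<lambda>n e a. \<not> P n e a", OF definable_not[OF assms]]]
  by simp

lemmas definable_intros =
  definable_eq definable_not definable_conj definable_disj definable_imp definable_iff
  definable_ex definable_all

text \<open>Only arguments in the universe matter, so \<open>Q\<close> may be a version of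
  \<open>P\<close> whose quantifiers are bounded by \<open>n\<close>.\<close>

lemma definable_cong1:
  assumes "\<And>n a. a \<le> n \<Longrightarrow> P n a \<longleftrightarrow> Q n a"
    and "definable N (\<lambda>n e. Q n (e x))"
  shows "definable N (\<lambda>n e. P n (e x))"
  using assms(2) unfolding definable_def by (simp add: assms(1))

lemma definable_cong2:
  assumes "\<And>n a b. a \<le> n \<Longrightarrow> b \<le> n \<Longrightarrow> P n a b \<longleftrightarrow> Q n a b"
    and "definable N (\<lambda>n e. Q n (e x) (e y))"
  shows "definable N (\<lambda>n e. P n (e x) (e y))"
  using assms(2) unfolding definable_def by (simp add: assms(1))

text \<open>An atom with the wrong number of arguments is false under every assignment.\<close>

lemma definable_binary_atom:
  assumes "\<And>x y. definable N (\<lambda>n e. R (e x) (e y))"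
  shows "definable N (\<lambda>n e. map e xs \<in> {[a, b] | a b. R a b})"
proof (cases "\<exists>x y. xs = [x, y]")
  case True
  then show ?thesis using assms by auto
next
  case False
  then have "map e xs \<in> {[a, b] | a b. R a b} \<longleftrightarrow> False" for e
    by (auto simp: map_eq_Cons_conv)
  then show ?thesis by (simp only: definable_False)
qed

text \<open>Only numerical atoms have to be replaced. Their range condition in \<open>sat\<close>
  holds because assignments take values in the universe.\<close>

lemma translate_formula:
  fixes N1 :: "'p \<Rightarrow> nat list set" and N2 :: "'q \<Rightarrow> nat list set" and \<phi> :: "(nat, 'p) fo"
  assumes "\<And>P xs. definable N2 (\<lambda>n e. map e xs \<in> N1 P)"
  shows "\<exists>\<psi> :: (nat, 'q) fo. fo_equiv N1 \<phi> N2 \<psi>"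
proof (induction \<phi>)
  case (Rel R xs)
  show ?case by (rule exI[of _ "Rel R xs"]) (simp add: fo_equiv_def)
next
  case (Num P xs)
  obtain \<psi> :: "(nat, 'q) fo" where
    "\<forall>n I s. (\<forall>x. s x \<le> n) \<longrightarrow> (sat N2 n I s \<psi> \<longleftrightarrow> map s xs \<in> N1 P)"
    using assms[of xs P] unfolding definable_def by blast
  then show ?case by (intro exI[of _ \<psi>]) (auto simp: fo_equiv_def)
next
  case (Eq x y)
  show ?case by (rule exI[of _ "Eq x y"]) (simp add: fo_equiv_def)
next
  case (Neg \<phi>)
  then obtain \<psi> :: "(nat, 'q) fo" where "fo_equiv N1 \<phi> N2 \<psi>" by blast
  then show ?case by (intro exI[of _ "Neg \<psi>"]) (simp add: fo_equiv_def)
next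
  case (Conj \<phi>1 \<phi>2)
  then obtain \<psi>1 \<psi>2 :: "(nat, 'q) fo" where "fo_equiv N1 \<phi>1 N2 \<psi>1" "fo_equiv N1 \<phi>2 N2 \<psi>2"
    by blast
  then show ?case by (intro exI[of _ "Conj \<psi>1 \<psi>2"]) (simp add: fo_equiv_def)
next
  case (Ex x \<phi>)
  then obtain \<psi> :: "(nat, 'q) fo" where "fo_equiv N1 \<phi> N2 \<psi>" by blast
  then show ?case by (intro exI[of _ "Ex x \<psi>"]) (simp add: fo_equiv_def)
qed

section \<open>The order is definable from Bit\<close>

lemma bit_less: "bit (a :: nat) i \<Longrightarrow> i < a"
  by (metis bit_iff_odd div_less even_zero less_exp less_le_trans linorder_not_less)

text \<open>Division by \<open>2 ^ i\<close> leaves an odd quotient of \<open>b\<close> and an even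
  quotient of \<open>a\<close> with equal halves, and division is monotone.\<close>

lemma less_if_top_bit:
  fixes a b :: nat
  assumes "bit b i" "\<not> bit a i" and "\<And>j. i < j \<Longrightarrow> bit a j = bit b j"
  shows "a < b"
proof -
  have "drop_bit (Suc i) a = drop_bit (Suc i) b"
    using assms(3) by (intro bit_eqI) (simp add: bit_drop_bit_eq)
  then have "a div 2 ^ i div 2 = b div 2 ^ i div 2"
    by (simp add: drop_bit_eq_div mult.commute flip: div_mult2_eq)
  moreover have "odd (b div 2 ^ i)" "even (a div 2 ^ i)"
    using assms by (simp_all add: bit_iff_odd)
  ultimately have "a div 2 ^ i < b div 2 ^ i"
    by (metis even_two_times_div_two lessI odd_two_times_div_two_succ Suc_eq_plus1)
  then show ?thesis
    by (meson div_le_mono linorder_not_less)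
qed

lemma obtain_top_bit:
  fixes a b :: nat
  assumes "a < b"
  obtains i where "bit b i" "\<not> bit a i" "\<And>j. i < j \<Longrightarrow> bit a j = bit b j"
proof -
  let ?D = "{i. bit a i \<noteq> bit b i}"
  have "?D \<subseteq> {..<b}"
    using bit_less assms by (auto dest!: bit_less)
  then have fin: "finite ?D" by (rule finite_subset) simp
  have "?D \<noteq> {}" using assms bit_eqI[of a b] by auto
  define m where "m = Max ?D"
  have "m \<in> ?D" unfolding m_def by (rule Max_in) fact+
  then have m: "bit a m \<noteq> bit b m" by simp
  have agree: "bit a j = bit b j" if "m < j" for j
  proof (rule ccontr)
    assume "bit a j \<noteq> bit b j"
    then have "j \<le> m" unfolding m_def using fin by (intro Max_ge) auto
    then show False using that by simp
  qed
  show ?thesis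
  proof (cases "bit b m")
    case True
    show ?thesis by (rule that[of m]) (use True m agree in simp_all)
  next
    case False
    have "b < a" by (rule less_if_top_bit[of a m]) (use False m agree in simp_all)
    then show ?thesis using assms by simp
  qed
qed

text \<open>One lift: \<open>L\<close> compares bit positions and makes \<open>i\<close> the highest
  differing one. The bound \<open>n\<close> loses nothing, since the set bits of a number have
  positions below it.\<close>

definition lex_less :: "nat \<Rightarrow> (nat \<Rightarrow> nat \<Rightarrow> bool) \<Rightarrow> nat \<Rightarrow> nat \<Rightarrow> bool" where
  "lex_less n L a b \<longleftrightarrow>
     (\<exists>i\<le>n. bit b i \<and> \<not> bit a i \<and> (\<forall>j\<le>n. (bit a j \<longleftrightarrow> \<not> bit b j) \<and> j \<noteq> i \<longrightarrow> L j i))"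

text \<open>Correctness of \<open>L\<close> is required only for \<open>i < b\<close>, because a set
  bit of \<open>b\<close> has position below \<open>b\<close>. This form permits the induction in
  \<open>sep_sound\<close>.\<close>

lemma lex_less_sound:
  assumes "lex_less n L a b" "a \<le> n" "b \<le> n"
    and "\<And>i j. i < b \<Longrightarrow> i \<le> n \<Longrightarrow> j \<le> n \<Longrightarrow> L j i \<Longrightarrow> j < i"
  shows "a < b"
proof -
  obtain i where i: "i \<le> n" "bit b i" "\<not> bit a i"
      "\<And>j. j \<le> n \<Longrightarrow> bit a j \<noteq> bit b j \<Longrightarrow> j \<noteq> i \<Longrightarrow> L j i"
    using assms(1) unfolding lex_less_def by blast
  have "bit a j = bit b j" if "i < j" for j
  proof (rule ccontr)
    assume d: "bit a j \<noteq> bit b j"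
    then have "j \<le> n" using bit_less[of a j] bit_less[of b j] assms(2,3) by auto
    then have "j < i" using i d that assms(4) bit_less by blast
    then show False using that by simp
  qed
  then show ?thesis using i less_if_top_bit by blast
qed

text \<open>For \<open>b < 2 ^ k\<close> the highest differing bit lies below \<open>k\<close>, and
  so do all other differing bits; \<open>L\<close> is consulted only there.\<close>

lemma lex_less_complete:
  assumes L: "\<And>i j. j < i \<Longrightarrow> i < k \<Longrightarrow> L j i"
    and "a < b" "b < 2 ^ k" "b \<le> n"
  shows "lex_less n L a b"
proof -
  obtain i where i: "bit b i" "\<not> bit a i" "\<And>j. i < j \<Longrightarrow> bit a j = bit b j"
    using obtain_top_bit[OF assms(2)] by blast
  have "i < k"
  proof (rule ccontr)
    assume "\<not> i < k"
    then have "(2::nat) ^ k \<le> 2 ^ i" by simp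
    then have "b < 2 ^ i" using assms by linarith
    then show False using i by (simp add: bit_iff_odd)
  qed
  have "L j i" if "bit a j \<longleftrightarrow> \<not> bit b j" "j \<noteq> i" for j
    using L[of j i] \<open>i < k\<close> i(3)[of j] that by (meson linorder_neqE_nat)
  moreover have "i \<le> n" using bit_less[OF i(1)] assms by simp
  ultimately show ?thesis unfolding lex_less_def using i by blast
qed

section \<open>Coding the order on small numbers by a single element\<close>

text \<open>A number \<open>W\<close> is read as a set of sets; \<open>sep n W\<close> is the order it induces when these sets
  are initial segments. Being well-separated forces this by recursion on the larger argument.\<close>

definition sep :: "nat \<Rightarrow> nat \<Rightarrow> nat \<Rightarrow> nat \<Rightarrow> bool" where
  "sep n W a b \<longleftrightarrow> (\<exists>S\<le>n. bit W S \<and> bit S a \<and> \<not> bit S b) \<and> (\<exists>S\<le>n. bit W S \<and> bit S b)"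

definition well_separated :: "nat \<Rightarrow> nat \<Rightarrow> bool" where
  "well_separated n W \<longleftrightarrow> (\<forall>a\<le>n. \<forall>b\<le>n. sep n W a b \<longrightarrow> lex_less n (sep n W) a b)"

text \<open>Every well-separated \<open>W\<close> gives a relation contained in \<open><\<close>, so
  no particular code has to be singled out.\<close>

definition small_less :: "nat \<Rightarrow> nat \<Rightarrow> nat \<Rightarrow> bool" where
  "small_less n a b \<longleftrightarrow> (\<exists>W\<le>n. well_separated n W \<and> sep n W a b)"

lemma sep_sound:
  assumes "well_separated n W"
  shows "sep n W a b \<Longrightarrow> a \<le> n \<Longrightarrow> b \<le> n \<Longrightarrow> a < b"
proof (induction b arbitrary: a rule: less_induct)
  case (less b)
  then have "lex_less n (sep n W) a b"
    using assms unfolding well_separated_def by blast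
  then show ?case using less by (elim lex_less_sound) auto
qed

text \<open>The witness \<open>W\<close> codes the set of the initial segments
  \<open>{0..<k}\<close> with \<open>k <= m\<close>. Each has the code
  \<open>mask k < 2 ^ m\<close>, whence \<open>W < 2 ^ 2 ^ m\<close>.\<close>

lemma small_less_complete:
  assumes "2 ^ 2 ^ m \<le> n" "a < b" "b < m"
  shows "small_less n a b"
proof -
  define A :: "nat set" where "A = mask ` {..m}"
  define W where "W = set_encode A"
  have "finite A" by (simp add: A_def)
  then have W: "bit W S \<longleftrightarrow> S \<in> A" for S
    unfolding W_def using set_encode_inverse[of A] by (auto simp: set_decode_def bit_iff_odd)
  have A_less: "S < 2 ^ m" if "S \<in> A" for S
  proof -
    obtain k where "k \<le> m" "S = 2 ^ k - 1"
      using \<open>S \<in> A\<close> by (auto simp: A_def mask_eq_exp_minus_1)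
    moreover have "(2::nat) ^ k \<le> 2 ^ m" using \<open>k \<le> m\<close> by simp
    moreover have "(0::nat) < 2 ^ k" by simp
    ultimately show ?thesis by linarith
  qed
  have "take_bit (2 ^ m) W = W"
    by (intro bit_eqI) (auto simp: bit_take_bit_iff W A_less)
  then have "W < 2 ^ 2 ^ m" by (metis take_bit_nat_less_exp)
  then have "W \<le> n" using assms by simp
  have mask_le: "mask k \<le> n" if "k \<le> m" for k
  proof -
    have "mask k < (2::nat) ^ m" using that by (intro A_less) (simp add: A_def)
    then show ?thesis using assms(1) less_exp[of "2 ^ m"] by linarith
  qed
  have sep: "sep n W j i \<longleftrightarrow> j < i \<and> i < m" if "i \<le> n" "j \<le> n" for i j
  proof
    assume "sep n W j i"
    then show "j < i \<and> i < m" by (auto simp: sep_def W A_def bit_mask_iff)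
  next
    assume *: "j < i \<and> i < m"
    show "sep n W j i" unfolding sep_def
    proof
      show "\<exists>S\<le>n. bit W S \<and> bit S j \<and> \<not> bit S i"
        using * mask_le[of i] by (intro exI[of _ "mask i"]) (auto simp: W A_def bit_mask_iff)
      show "\<exists>S\<le>n. bit W S \<and> bit S i"
        using * mask_le[of "Suc i"]
        by (intro exI[of _ "mask (Suc i)"]) (auto simp: W A_def bit_mask_iff simp del: mask_Suc_exp)
    qed
  qed
  have m: "m \<le> n" using assms(1) less_exp[of m] less_exp[of "2 ^ m"] by linarith
  \<comment> \<open>Since \<open>sep n W\<close> is the full order below \<open>m\<close>, one lift
    is complete below \<open>2 ^ m\<close>, in particular below \<open>m\<close>.\<close>
  have "lex_less n (sep n W) a b" if "sep n W a b" "a \<le> n" "b \<le> n" for a b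
  proof (rule lex_less_complete)
    show "sep n W j i" if "j < i" "i < m" for i j using that m sep by auto
    show "a < b" "b \<le> n" using that sep by auto
    have "b < m" using that sep by auto
    then show "b < 2 ^ m" using less_exp[of m] by linarith
  qed
  then have "well_separated n W" unfolding well_separated_def by blast
  moreover have "sep n W a b" using assms m by (subst sep) auto
  ultimately show ?thesis using \<open>W \<le> n\<close> unfolding small_less_def by blast
qed

lemma less_iff_lex:
  assumes "a \<le> n" "b \<le> n"
  shows "a < b \<longleftrightarrow> lex_less n (lex_less n (lex_less n (small_less n))) a b"
proof
  \<comment> \<open>Minimality makes \<open>small_less\<close> complete below \<open>m\<close>,
    while \<open>n\<close> stays below \<open>2 ^ 2 ^ Suc m\<close>.\<close>
  define m where "m = (LEAST m. n < 2 ^ 2 ^ Suc m)"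
  have "n < 2 ^ 2 ^ Suc n"
    using less_exp[of "Suc n"] less_exp[of "2 ^ Suc n"] by linarith
  then have up: "n < 2 ^ 2 ^ Suc m" unfolding m_def by (rule LeastI)
  have small: "small_less n a b" if "a < b" "b < m" for a b
  proof (rule small_less_complete[OF _ that])
    \<comment> \<open>Minimality says nothing for \<open>m = 0\<close>, but then no
      \<open>b < m\<close> exists.\<close>
    obtain m' where "m = Suc m'" using \<open>b < m\<close> by (cases m) auto
    then have "\<not> n < 2 ^ 2 ^ Suc m'" using not_less_Least[of m' "\<lambda>m. n < 2 ^ 2 ^ Suc m"]
      unfolding m_def by auto
    then show "2 ^ 2 ^ m \<le> n" using \<open>m = Suc m'\<close> by simp
  qed
  have l1: "lex_less n (small_less n) a b" if "a < b" "b < 2 ^ m" "b \<le> n" for a b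
    using small that by (rule lex_less_complete)
  have l2: "lex_less n (lex_less n (small_less n)) a b" if "a < b" "b < 2 ^ 2 ^ m" "b \<le> n" for a b
  proof -
    \<comment> \<open>\<open>l1\<close> holds only for \<open>b <= n\<close>; the guard makes the
      relation complete below \<open>2 ^ m\<close>, and it disappears again because
      \<open>lex_less\<close> consults only positions up to \<open>n\<close>.\<close>
    have "lex_less n (\<lambda>a b. b \<le> n \<longrightarrow> lex_less n (small_less n) a b) a b"
      using l1 that by (intro lex_less_complete[where k = "2 ^ m"]) auto
    then show ?thesis by (auto simp: lex_less_def)
  qed
  have l3: "lex_less n (lex_less n (lex_less n (small_less n))) a b"
    if "a < b" "b < 2 ^ 2 ^ 2 ^ m" "b \<le> n" for a b
  proof -
    have "lex_less n (\<lambda>a b. b \<le> n \<longrightarrow> lex_less n (lex_less n (small_less n)) a b) a b"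
      using l2 that by (intro lex_less_complete[where k = "2 ^ 2 ^ m"]) auto
    then show ?thesis unfolding lex_less_def[of n _ a b] by auto
  qed
  \<comment> \<open>This is why three lifts suffice: \<open>2 ^ 2 ^ 2 ^ m\<close> exceeds
    \<open>n\<close>.\<close>
  have "Suc m \<le> 2 ^ m" using less_exp[of m] by (simp add: Suc_le_eq)
  then have "(2::nat) ^ 2 ^ Suc m \<le> 2 ^ 2 ^ 2 ^ m"
    by (intro power_increasing) auto
  then show "lex_less n (lex_less n (lex_less n (small_less n))) a b" if "a < b"
    using l3[OF that] up assms(2) by linarith
next
  have s0: "small_less n a b \<Longrightarrow> a \<le> n \<Longrightarrow> b \<le> n \<Longrightarrow> a < b" for a b
    unfolding small_less_def using sep_sound by blast
  have s1: "lex_less n (small_less n) a b \<Longrightarrow> a \<le> n \<Longrightarrow> b \<le> n \<Longrightarrow> a < b" for a b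
    by (erule lex_less_sound) (use s0 in auto)
  have s2: "lex_less n (lex_less n (small_less n)) a b \<Longrightarrow> a \<le> n \<Longrightarrow> b \<le> n \<Longrightarrow> a < b" for a b
    by (erule lex_less_sound) (use s1 in auto)
  assume "lex_less n (lex_less n (lex_less n (small_less n))) a b"
  then show "a < b" using assms by (rule lex_less_sound) (use s2 in auto)
qed

lemma definable_lex_less:
  assumes "\<And>x y. definable N (\<lambda>n e. bit (e x) (e y))"
    and "\<And>x y. definable N (\<lambda>n e. L n (e x) (e y))"
  shows "definable N (\<lambda>n e. lex_less n (L n) (e x) (e y))"
  unfolding lex_less_def by (intro definable_intros assms)

lemma definable_less:
  assumes bit: "\<And>x y. definable N (\<lambda>n e. bit (e x) (e y))"
  shows "definable N (\<lambda>n e. e x < e y)"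
proof -
  have small: "definable N (\<lambda>n e. small_less n (e x) (e y))" for x y
    unfolding small_less_def well_separated_def sep_def lex_less_def
    by (intro definable_intros bit)
  show ?thesis
    by (rule definable_cong2[OF less_iff_lex]) (assumption | intro definable_lex_less bit small)+
qed

section \<open>The second order\<close>

definition rev_less :: "nat \<Rightarrow> nat \<Rightarrow> bool" where
  "rev_less a b \<longleftrightarrow> (\<exists>i. \<not> bit a i \<and> bit b i \<and> (\<forall>j<i. bit a j = bit b j))"

lemma rev_less_total:
  assumes "a \<noteq> b"
  shows "rev_less a b \<or> rev_less b a"
proof -
  have "\<exists>i. bit a i \<noteq> bit b i" using assms by (auto intro: bit_eqI)
  then obtain i where "bit a i \<noteq> bit b i" "\<forall>j<i. bit a j = bit b j"
    using exists_least_iff[of "\<lambda>i. bit a i \<noteq> bit b i"] by auto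
  then show ?thesis unfolding rev_less_def by metis
qed

lemma rev_less_irrefl: "\<not> rev_less a a"
  by (simp add: rev_less_def)

lemma rev_less_trans:
  assumes "rev_less a b" "rev_less b c"
  shows "rev_less a c"
proof -
  obtain i where i: "\<not> bit a i" "bit b i" "\<forall>j<i. bit a j = bit b j"
    using assms(1) unfolding rev_less_def by blast
  obtain k where k: "\<not> bit b k" "bit c k" "\<forall>j<k. bit b j = bit c j"
    using assms(2) unfolding rev_less_def by blast
  have "i \<noteq> k" using i k by auto
  then show ?thesis unfolding rev_less_def using i k
    by (intro exI[of _ "min i k"]) (auto simp: min_def)
qed

lemma rev_less_asym: "rev_less a b \<Longrightarrow> \<not> rev_less b a"
  using rev_less_trans rev_less_irrefl by blast

text \<open>If \<open>y\<close> differs from \<open>take_bit k a\<close>, the first difference lies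
  below \<open>k\<close>, where \<open>a\<close> has the same bits. If they are equal,
  \<open>a\<close> has every bit of \<open>y\<close> and cannot precede it. Thus
  \<open>take_bit k a\<close> is the last number below \<open>2 ^ k\<close> not after
  \<open>a\<close>.\<close>

lemma rev_less_take_bit:
  assumes "y < 2 ^ k"
  shows "y = a \<or> rev_less y a \<longleftrightarrow> y = take_bit k a \<or> rev_less y (take_bit k a)"
proof (cases "y = take_bit k a")
  case True
  have "rev_less y a" if "y \<noteq> a"
  proof -
    have "\<not> rev_less a y"
    proof
      assume "rev_less a y"
      then obtain i where "\<not> bit a i" "bit y i" unfolding rev_less_def by blast
      then show False by (simp add: True bit_take_bit_iff)
    qed
    then show ?thesis using rev_less_total that by blast
  qed
  then show ?thesis using True by blast
next
  case False
  have y: "take_bit k y = y" using assms by (simp add: take_bit_nat_eq_self_iff)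
  then have "\<exists>i. bit y i \<noteq> bit (take_bit k a) i" using False by (auto intro: bit_eqI)
  then obtain i where i: "bit y i \<noteq> bit (take_bit k a) i"
      and below: "\<forall>j<i. bit y j = bit (take_bit k a) j"
    using exists_least_iff[of "\<lambda>i. bit y i \<noteq> bit (take_bit k a) i"] by auto
  have "i < k" using i y by (metis bit_take_bit_iff)
  then have i': "bit y i \<noteq> bit a i" and below': "\<forall>j<i. bit y j = bit a j"
    using i below by (auto simp: bit_take_bit_iff)
  have "rev_less y b \<longleftrightarrow> bit b i" if "bit y i \<noteq> bit b i" "\<forall>j<i. bit y j = bit b j" for b
  proof
    show "rev_less y b" if "bit b i"
      using that \<open>bit y i \<noteq> bit b i\<close> \<open>\<forall>j<i. bit y j = bit b j\<close> unfolding rev_less_def by blast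
    show "bit b i" if "rev_less y b"
    proof (rule ccontr)
      assume "\<not> bit b i"
      then have "rev_less b y"
        using \<open>bit y i \<noteq> bit b i\<close> \<open>\<forall>j<i. bit y j = bit b j\<close> unfolding rev_less_def by blast
      then show False using that rev_less_asym by blast
    qed
  qed
  from this[OF i' below'] this[OF i below]
  have "rev_less y a \<longleftrightarrow> rev_less y (take_bit k a)"
    using \<open>i < k\<close> by (simp add: bit_take_bit_iff)
  moreover have "y \<noteq> a" using i' by auto
  ultimately show ?thesis using False by blast
qed

text \<open>Ordinary numbers take even keys; the odd key just after the key \<open>2 * i\<close> is
  reserved for \<open>2 ^ i - 1\<close>, so keys stay distinct.\<close>

definition odd_key :: "nat \<Rightarrow> nat" where
  "odd_key a = (if \<exists>i. a = mask i then 2 * (THE i. a = mask i) + 1 else 2 * a)"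

lemma mask_nat_inject: "mask i = (mask j :: nat) \<longleftrightarrow> i = j"
  by (metis bit_mask_iff linorder_neqE_nat less_irrefl possible_bit_nat)

lemma le_mask_nat: "i \<le> (mask i :: nat)"
  using less_exp[of i] unfolding mask_eq_exp_minus_1 by linarith

lemma odd_key_mask: "odd_key (mask i) = 2 * i + 1"
  by (auto simp: odd_key_def mask_nat_inject)

lemma odd_key_ordinary: "\<nexists>i. a = mask i \<Longrightarrow> odd_key a = 2 * a"
  by (simp add: odd_key_def)

lemma odd_key_inject: "odd_key a = odd_key b \<Longrightarrow> a = b"
proof (cases "\<exists>i. a = mask i"; cases "\<exists>i. b = mask i")
  assume "odd_key a = odd_key b" "\<exists>i. a = mask i" "\<nexists>i. b = mask i"
  then show "a = b" by (elim exE) (simp add: odd_key_mask odd_key_ordinary, presburger)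
next
  assume "odd_key a = odd_key b" "\<nexists>i. a = mask i" "\<exists>i. b = mask i"
  then show "a = b" by (elim exE) (simp add: odd_key_mask odd_key_ordinary, presburger)
qed (auto simp: odd_key_mask odd_key_ordinary)

text \<open>The cases compare keys by parity: \<open>2 * i + 1 < 2 * b\<close> iff
  \<open>i < b\<close>, and \<open>2 * a < 2 * i + 1\<close> iff not \<open>i < a\<close>. The
  bounds are harmless since \<open>i <= mask i\<close>.\<close>

lemma odd_key_less_iff:
  assumes "a \<le> n" "b \<le> n"
  shows "odd_key a < odd_key b \<longleftrightarrow>
    (\<exists>i\<le>n. a = mask i) \<and> (\<exists>i\<le>n. b = mask i) \<and> a < b \<or>
    (\<exists>i\<le>n. a = mask i \<and> i < b) \<and> \<not> (\<exists>i\<le>n. b = mask i) \<or>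
    \<not> (\<exists>i\<le>n. a = mask i) \<and> (\<exists>i\<le>n. b = mask i \<and> \<not> i < a) \<or>
    \<not> (\<exists>i\<le>n. a = mask i) \<and> \<not> (\<exists>i\<le>n. b = mask i) \<and> a < b"
proof -
  have bounded: "(\<exists>i\<le>n. c = mask i \<and> P i) \<longleftrightarrow> (\<exists>i. c = mask i \<and> P i)" if "c \<le> n" for c P
    using that le_mask_nat order_trans by blast
  have bounded': "(\<exists>i\<le>n. c = mask i) \<longleftrightarrow> (\<exists>i. c = mask i)" if "c \<le> n" for c
    using bounded[OF that, of "\<lambda>_. True"] by simp
  have mono: "mask i < (mask j :: nat) \<longleftrightarrow> i < j" for i j
    by (simp add: mask_eq_exp_minus_1 less_diff_iff)
  show ?thesis
    unfolding bounded[OF assms(1)] bounded[OF assms(2)] bounded'[OF assms(1)] bounded'[OF assms(2)]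
    by (cases "\<exists>i. a = mask i"; cases "\<exists>i. b = mask i")
      (auto simp: odd_key_mask odd_key_ordinary mono mask_nat_inject)
qed

section \<open>The combined order and its definability from Bit\<close>

definition prec :: "nat \<Rightarrow> nat \<Rightarrow> bool" where
  "prec a b \<longleftrightarrow> (even a \<and> odd b) \<or> (even a \<and> even b \<and> rev_less a b) \<or>
     (odd a \<and> odd b \<and> odd_key a < odd_key b)"

lemma strict_linear_order_prec: "strict_linear_order {(a, b). prec a b}"
  unfolding strict_linear_order_on_def
proof (intro conjI)
  show "trans {(a, b). prec a b}"
    by (rule transI) (auto simp: prec_def intro: rev_less_trans)
  show "irrefl {(a, b). prec a b}"
    by (rule irreflI) (auto simp: prec_def rev_less_irrefl)
  show "total {(a, b). prec a b}"
  proof (rule totalI)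
    fix a b :: nat
    assume "a \<noteq> b"
    then show "(a, b) \<in> {(a, b). prec a b} \<or> (b, a) \<in> {(a, b). prec a b}"
      using rev_less_total[of a b] odd_key_inject[of a b]
      by (cases "odd_key a" "odd_key b" rule: linorder_cases) (auto simp: prec_def)
  qed
qed

lemma definable_prec:
  assumes bit: "\<And>x y. definable N (\<lambda>n e. bit (e x) (e y))"
  shows "definable N (\<lambda>n e. prec (e x) (e y))"
proof -
  note less = definable_less[OF bit]
  have even: "definable N (\<lambda>n e. even (e x))" for x
  proof (rule definable_cong1)
    \<comment> \<open>The condition on \<open>z\<close> singles out 0, so the formula tests bit
      0.\<close>
    show "even a \<longleftrightarrow> (\<forall>z\<le>n. (\<forall>i\<le>n. \<not> i < z) \<longrightarrow> \<not> bit a z)" if "a \<le> n" for n a :: nat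
      using that by (auto simp: bit_0)
  qed (intro definable_intros bit less)
  have rev: "definable N (\<lambda>n e. rev_less (e x) (e y))" for x y
  proof (rule definable_cong2)
    show "rev_less a b \<longleftrightarrow>
        (\<exists>i\<le>n. \<not> bit a i \<and> bit b i \<and> (\<forall>j\<le>n. j < i \<longrightarrow> (bit a j \<longleftrightarrow> bit b j)))"
      if "a \<le> n" "b \<le> n" for n a b :: nat
      unfolding rev_less_def using bit_less[of b] that
      by (meson le_trans less_imp_le less_trans)
  qed (intro definable_intros bit less)
  have mask: "definable N (\<lambda>n e. e x = mask (e y))" for x y
  proof (rule definable_cong2)
    show "a = mask i \<longleftrightarrow> (\<forall>j\<le>n. bit a j \<longleftrightarrow> j < i)" if "a \<le> n" "i \<le> n" for n a i :: nat
    proof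
      assume *: "\<forall>j\<le>n. bit a j \<longleftrightarrow> j < i"
      show "a = mask i"
      proof (rule bit_eqI)
        show "bit a j \<longleftrightarrow> bit (mask i :: nat) j" for j
          using * that bit_less[of a j] by (cases "j \<le> n") (auto simp: bit_mask_iff)
      qed
    qed (auto simp: bit_mask_iff)
  qed (intro definable_intros bit less)
  have key: "definable N (\<lambda>n e. odd_key (e x) < odd_key (e y))" for x y
    by (rule definable_cong2[OF odd_key_less_iff]) (assumption | intro definable_intros less mask)+
  show ?thesis unfolding prec_def by (intro definable_intros even rev key)
qed

section \<open>Bit is definable from the two orders\<close>

definition pow2 :: "nat \<Rightarrow> bool" where
  "pow2 p \<longleftrightarrow> (\<exists>k. p = 2 ^ k)"

lemma bit_pow2_iff: "bit (2 ^ k :: nat) i \<longleftrightarrow> i = k"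
  by (auto simp: bit_exp_iff)

text \<open>A positive \<open>y < 2 ^ k\<close> has its lowest set bit below \<open>k\<close>, where
  \<open>2 ^ k\<close> has none. Conversely, if \<open>p\<close> is not a power of two and
  \<open>i\<close> is its lowest set bit, then \<open>2 ^ i < p\<close>, and \<open>p\<close> does
  not precede \<open>2 ^ i\<close> because it contains its only bit. The odd power 1 is treated
  apart.\<close>

lemma pow2_iff:
  assumes "p \<le> n"
  shows "pow2 p \<longleftrightarrow> p \<noteq> 0 \<and> (even p \<or> p = 1) \<and>
    (\<forall>y\<le>n. even y \<and> y \<noteq> 0 \<and> y < p \<longrightarrow> prec p y)"
proof
  assume "pow2 p"
  then obtain k where k: "p = 2 ^ k" by (auto simp: pow2_def)
  have "prec p y" if y: "even y" "y \<noteq> 0" "y < p" for y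
  proof -
    have "\<exists>i. bit y i" using y(2) bit_eqI[of y 0] by auto
    then obtain i where i: "bit y i" "\<forall>j<i. \<not> bit y j"
      using exists_least_iff[of "bit y"] by auto
    have "i < k"
    proof (rule ccontr)
      assume "\<not> i < k"
      then have "y < 2 ^ i" using y(3) k by (meson less_le_trans linorder_not_less one_le_numeral power_increasing)
      then show False using i(1) by (simp add: bit_iff_odd)
    qed
    then have "rev_less p y" unfolding rev_less_def using i by (auto simp: k bit_pow2_iff)
    moreover have "even p" using \<open>i < k\<close> by (simp add: k)
    ultimately show ?thesis using y by (simp add: prec_def)
  qed
  then show "p \<noteq> 0 \<and> (even p \<or> p = 1) \<and> (\<forall>y\<le>n. even y \<and> y \<noteq> 0 \<and> y < p \<longrightarrow> prec p y)"
    by (auto simp: k)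
next
  assume *: "p \<noteq> 0 \<and> (even p \<or> p = 1) \<and> (\<forall>y\<le>n. even y \<and> y \<noteq> 0 \<and> y < p \<longrightarrow> prec p y)"
  show "pow2 p"
  proof (cases "p = 1")
    case True
    then show ?thesis unfolding pow2_def by (intro exI[of _ 0]) simp
  next
    case False
    then have "even p" using * by blast
    have "\<exists>i. bit p i" using * bit_eqI[of p 0] by auto
    then obtain i where i: "bit p i" "\<forall>j<i. \<not> bit p j"
      using exists_least_iff[of "bit p"] by auto
    have "i \<noteq> 0" using i(1) \<open>even p\<close> by (metis bit_0)
    have le: "2 ^ i \<le> p"
      using i(1) by (metis bit_iff_odd div_less even_zero linorder_not_less)
    show ?thesis
    proof (rule ccontr)
      assume "\<not> pow2 p"
      then have "2 ^ i \<noteq> p" by (auto simp: pow2_def)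
      then have "prec p (2 ^ i)" using * le assms \<open>i \<noteq> 0\<close> by auto
      then have "rev_less p (2 ^ i)" using \<open>even p\<close> \<open>i \<noteq> 0\<close> by (simp add: prec_def)
      then obtain d where "\<not> bit p d" "bit (2 ^ i :: nat) d" unfolding rev_less_def by blast
      then show False using i(1) by (simp add: bit_pow2_iff)
    qed
  qed
qed

lemma even_iff_prec:
  assumes "x \<le> n"
  shows "even x \<longleftrightarrow> (\<forall>y\<le>n. x = Suc y \<longrightarrow> prec x y)"
proof (cases x)
  case (Suc y)
  then show ?thesis using assms by (auto simp: prec_def)
qed simp

text \<open>\<open>2 * p\<close> may lie outside the universe and cannot be named; if so, no larger
  power of two is left and every \<open>y <= n\<close> qualifies.\<close>

lemma below_double_iff:
  assumes "p \<le> n" "y \<le> n"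
  shows "pow2 p \<and> y < 2 * p \<longleftrightarrow> pow2 p \<and> (\<forall>q\<le>n. pow2 q \<and> p < q \<longrightarrow> y < q)"
proof (cases "pow2 p")
  case True
  then obtain k where k: "p = 2 ^ k" by (auto simp: pow2_def)
  have "2 * p \<le> q" if "pow2 q" "p < q" for q
  proof -
    obtain l where l: "q = 2 ^ l" using \<open>pow2 q\<close> unfolding pow2_def by blast
    then have "Suc k \<le> l" using that k by simp
    then have "(2::nat) ^ Suc k \<le> 2 ^ l" by (intro power_increasing) auto
    then show ?thesis using k l by simp
  qed
  moreover have "pow2 (2 * p)" unfolding pow2_def k by (metis power_Suc)
  moreover have "p < 2 * p" by (simp add: k)
  ultimately show ?thesis using assms True by (metis less_le_trans linorder_not_less)
qed simp

text \<open>The witness \<open>y\<close> is \<open>c\<close> modulo \<open>2 ^ Suc k\<close>.\<close>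

lemma bit_even_iff:
  assumes "even c" "c \<le> n" "0 < k"
  shows "bit c k \<longleftrightarrow> (\<exists>y\<le>n. even y \<and> \<not> y < 2 ^ k \<and> y < 2 * 2 ^ k \<and> (y = c \<or> prec y c) \<and>
    (\<forall>z\<le>n. even z \<and> z < 2 * 2 ^ k \<and> (z = c \<or> prec z c) \<longrightarrow> z = y \<or> prec z y))"
proof -
  let ?t = "take_bit (Suc k) c"
  have t: "even ?t" "?t \<le> n" "?t < 2 * 2 ^ k"
    using assms take_bit_nat_less_eq_self[of "Suc k" c] take_bit_nat_less_exp[of "Suc k" c]
    by (auto simp: even_take_bit_eq simp del: take_bit_nat_less_eq_self)
  have below: "z = c \<or> prec z c \<longleftrightarrow> z = ?t \<or> prec z ?t" if "even z" "z < 2 * 2 ^ k" for z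
    using rev_less_take_bit[of z "Suc k" c] that t assms by (auto simp: prec_def)
  \<comment> \<open>Bit \<open>k\<close> is the highest position that \<open>?t\<close> can
    have.\<close>
  have top: "bit c k \<longleftrightarrow> \<not> ?t < 2 ^ k"
  proof -
    have "?t < 2 ^ k \<longleftrightarrow> take_bit k ?t = ?t" by (rule take_bit_nat_eq_self_iff[symmetric])
    also have "\<dots> \<longleftrightarrow> \<not> bit c k"
    proof
      show "\<not> bit c k" if "take_bit k ?t = ?t"
        using arg_cong[OF that, of "\<lambda>a. bit a k"] by (simp add: bit_take_bit_iff)
      show "take_bit k ?t = ?t" if "\<not> bit c k"
        by (rule bit_eqI) (use that in \<open>auto simp: bit_take_bit_iff less_Suc_eq\<close>)
    qed
    finally show ?thesis by blast
  qed
  show ?thesis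
  proof
    assume "bit c k"
    then show "\<exists>y\<le>n. even y \<and> \<not> y < 2 ^ k \<and> y < 2 * 2 ^ k \<and> (y = c \<or> prec y c) \<and>
      (\<forall>z\<le>n. even z \<and> z < 2 * 2 ^ k \<and> (z = c \<or> prec z c) \<longrightarrow> z = y \<or> prec z y)"
      using t top below by (intro exI[of _ ?t]) blast
  next
    assume "\<exists>y\<le>n. even y \<and> \<not> y < 2 ^ k \<and> y < 2 * 2 ^ k \<and> (y = c \<or> prec y c) \<and>
      (\<forall>z\<le>n. even z \<and> z < 2 * 2 ^ k \<and> (z = c \<or> prec z c) \<longrightarrow> z = y \<or> prec z y)"
    then obtain y where y: "even y" "\<not> y < 2 ^ k" "y < 2 * 2 ^ k" "y = c \<or> prec y c"
      "\<forall>z\<le>n. even z \<and> z < 2 * 2 ^ k \<and> (z = c \<or> prec z c) \<longrightarrow> z = y \<or> prec z y" by blast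
    have "y = ?t \<or> prec y ?t" using y below by blast
    moreover have "?t = y \<or> prec ?t y" using y(5) t below by blast
    ultimately have "y = ?t" using t y(1) rev_less_asym by (auto simp: prec_def)
    then show "bit c k" using y(2) top by simp
  qed
qed

text \<open>Giving the position by its power of two separates reading a bit from defining
  exponentiation.\<close>

definition bit_at :: "nat \<Rightarrow> nat \<Rightarrow> bool" where
  "bit_at a p \<longleftrightarrow> (\<exists>k. p = 2 ^ k \<and> bit a k)"

text \<open>The reversed order is available on even numbers only, so \<open>c\<close> is
  \<open>a\<close> with bit 0 cleared; the other bits are unchanged.\<close>

lemma bit_at_iff:
  assumes "a \<le> n" "p \<le> n"
  shows "bit_at a p \<longleftrightarrow> p = 1 \<and> \<not> even a \<or>
    p \<noteq> 1 \<and> pow2 p \<and> (\<exists>c\<le>n. even c \<and> (c = a \<or> a = Suc c) \<and>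
      (\<exists>y\<le>n. even y \<and> \<not> y < p \<and> (pow2 p \<and> y < 2 * p) \<and> (y = c \<or> prec y c) \<and>
        (\<forall>z\<le>n. even z \<and> (pow2 p \<and> z < 2 * p) \<and> (z = c \<or> prec z c) \<longrightarrow> z = y \<or> prec z y)))"
    (is "_ \<longleftrightarrow> _ \<or> _ \<and> _ \<and> (\<exists>c\<le>n. _ c \<and> _ c \<and> ?Y c)")
proof (cases "pow2 p")
  case False
  then show ?thesis by (auto simp: bit_at_def pow2_def dest: spec[of _ 0])
next
  case True
  then obtain k where k: "p = 2 ^ k" by (auto simp: pow2_def)
  have at: "bit_at a p \<longleftrightarrow> bit a k" by (auto simp: bit_at_def k)
  show ?thesis
  proof (cases k)
    case 0
    then show ?thesis using at by (simp add: k bit_0)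
  next
    case (Suc l)
    have "p \<noteq> 1" by (simp add: k Suc)
    have "pow2 (2 ^ k)" "0 < k" using True by (simp_all add: k Suc)
    then have bit_c: "bit c k \<longleftrightarrow> ?Y c" if "even c" "c \<le> n" for c
      using bit_even_iff[OF that, of k] by (simp only: k simp_thms)
    have "bit a k \<longleftrightarrow> bit c k" if "even c" "c = a \<or> a = Suc c" for c
      using that by (auto simp: Suc bit_Suc)
    moreover have "\<exists>c\<le>n. even c \<and> (c = a \<or> a = Suc c)"
      using assms(1) by (cases "even a") (auto elim!: oddE intro: exI[of _ "a - 1"])
    ultimately have "bit a k \<longleftrightarrow> (\<exists>c\<le>n. even c \<and> (c = a \<or> a = Suc c) \<and> bit c k)" by blast
    also have "\<dots> \<longleftrightarrow> (\<exists>c\<le>n. even c \<and> (c = a \<or> a = Suc c) \<and> ?Y c)"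
      by (intro ex_cong1 conj_cong refl bit_c)
    finally show ?thesis using True \<open>p \<noteq> 1\<close> by (simp only: at simp_thms)
  qed
qed

section \<open>The graph of exponentiation\<close>

definition odd_exp :: "nat \<Rightarrow> nat \<Rightarrow> bool" where
  "odd_exp i p \<longleftrightarrow> odd i \<and> \<not> pow2 (Suc i) \<and> p = 2 ^ i"

lemma mask_Suc: "Suc (mask k) = 2 ^ k"
  by (simp add: mask_eq_exp_minus_1)

text \<open>As \<open>i\<close> is not of the form \<open>2 ^ k - 1\<close>, its key is
  \<open>2 * i\<close>. Hence the numbers \<open>2 ^ j - 1\<close> after \<open>i\<close> are those
  with \<open>j \<ge> i\<close>, and the first of them, \<open>v\<close>, is
  \<open>2 ^ i - 1\<close>.\<close>

lemma odd_exp_iff: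
  assumes "i \<le> n" "p \<le> n"
  shows "odd_exp i p \<longleftrightarrow> \<not> even i \<and> (\<exists>u\<le>n. u = Suc i \<and> \<not> pow2 u) \<and> pow2 p \<and>
    (\<exists>v\<le>n. p = Suc v \<and> prec i v \<and>
      (\<forall>q\<le>n. \<forall>w\<le>n. pow2 q \<and> q = Suc w \<and> prec i w \<longrightarrow> v = w \<or> prec v w))"
    (is "_ \<longleftrightarrow> ?R")
proof -
  have special: "prec i (mask j) \<longleftrightarrow> i \<le> j" if "odd i" "\<not> pow2 (Suc i)" for j
  proof -
    have "\<nexists>k. i = mask k" using that(2) mask_Suc by (auto simp: pow2_def)
    then have "odd_key i = 2 * i" by (rule odd_key_ordinary)
    \<comment> \<open>\<open>mask 0\<close> is even and so precedes \<open>i\<close>, in accordance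
      with \<open>0 < i\<close>.\<close>
    moreover have "odd (mask j :: nat) \<longleftrightarrow> j \<noteq> 0" by (simp add: even_mask_iff)
    ultimately show ?thesis using that(1) odd_pos[OF that(1)] by (cases "j = 0") (auto simp: prec_def odd_key_mask)
  qed
  have order: "prec (mask j) (mask k) \<longleftrightarrow> j < k" if "0 < j" "0 < k" for j k
    using that by (auto simp: prec_def even_mask_iff odd_key_mask)
  have pow2_Suc: "pow2 (Suc w) \<longleftrightarrow> (\<exists>j. w = mask j)" for w
    unfolding pow2_def using mask_Suc by (metis Suc_inject)
  show ?thesis
  proof
    assume "odd_exp i p"
    then have i: "odd i" "\<not> pow2 (Suc i)" "p = 2 ^ i" by (auto simp: odd_exp_def)
    \<comment> \<open>The bound \<open>p <= n\<close> already puts the witness \<open>u\<close> into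
      the universe.\<close>
    have "Suc i \<le> n" using less_exp[of i] i(3) assms by linarith
    moreover have "mask i \<le> n" using i(3) mask_Suc[of i] assms by linarith
    moreover have "mask i = w \<or> prec (mask i) w" if "pow2 (Suc w)" "prec i w" for w
    proof -
      obtain j where j: "w = mask j" using \<open>pow2 (Suc w)\<close> pow2_Suc by auto
      then have "i \<le> j" using special i that by blast
      moreover have "0 < i" using i(1) by (rule odd_pos)
      ultimately show ?thesis using order[of i j] j by (auto simp: le_less)
    qed
    moreover have "pow2 p" using i(3) unfolding pow2_def by blast
    ultimately show ?R using i special[of i] mask_Suc[of i]
      by (auto intro!: exI[of _ "mask i"])
  next
    assume ?R
    then obtain v where i: "odd i" "\<not> pow2 (Suc i)" and p: "pow2 p" "p = Suc v" "prec i v"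
      and min: "\<And>w. Suc w \<le> n \<Longrightarrow> pow2 (Suc w) \<Longrightarrow> prec i w \<Longrightarrow> v = w \<or> prec v w"
      by auto
    obtain j where j: "v = mask j" using p pow2_Suc by auto
    have "i \<le> j" using special i p(3) j by blast
    \<comment> \<open>Minimality of \<open>v\<close> can be applied to \<open>mask i\<close> only if
      \<open>2 ^ i\<close> lies in the universe.\<close>
    then have "(2::nat) ^ i \<le> 2 ^ j" by (intro power_increasing) auto
    then have "Suc (mask i) \<le> n" using mask_Suc[of i] mask_Suc[of j] p(2) j assms(2) by linarith
    then have "v = mask i \<or> prec v (mask i)"
      by (rule min) (use special[OF i, of i] in \<open>auto simp: pow2_Suc\<close>)
    moreover have "0 < i" using i(1) by (rule odd_pos)
    ultimately have "j = i" using order[of j i] j \<open>i \<le> j\<close> by (auto simp: mask_nat_inject)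
    then show "odd_exp i p" using i p(2) j mask_Suc[of i] by (simp add: odd_exp_def)
  qed
qed

text \<open>Extends a partial graph of exponentiation by the successors of its exponents.\<close>

definition exp_step :: "(nat \<Rightarrow> nat \<Rightarrow> bool) \<Rightarrow> nat \<Rightarrow> nat \<Rightarrow> bool" where
  "exp_step E i p \<longleftrightarrow> E i p \<or> (\<exists>j q. i = Suc j \<and> p = 2 * q \<and> pow2 q \<and> E j q)"

definition exp_base :: "nat \<Rightarrow> nat \<Rightarrow> bool" where
  "exp_base i p \<longleftrightarrow> i = 0 \<and> p = 1 \<or> odd_exp i p"

text \<open>Four steps suffice because, of two consecutive odd numbers above 1, at most one has the form
  \<open>2 ^ k - 1\<close>; the exponents up to 4 are reached from 0.\<close>

lemma exp_iff: "p = 2 ^ i \<longleftrightarrow> exp_step (exp_step (exp_step (exp_step exp_base))) i p"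
proof
  have base: "exp_base i p \<Longrightarrow> p = 2 ^ i" for i p
    by (auto simp: exp_base_def odd_exp_def)
  have step: "exp_step E i p \<Longrightarrow> (\<And>i p. E i p \<Longrightarrow> p = 2 ^ i) \<Longrightarrow> p = 2 ^ i" for E i p
    by (auto simp: exp_step_def)
  show "exp_step (exp_step (exp_step (exp_step exp_base))) i p \<Longrightarrow> p = 2 ^ i"
    using base step by blast
next
  assume p: "p = 2 ^ i"
  have keep: "exp_step E i (2 ^ i)" if "E i (2 ^ i)" for E i
    using that by (simp add: exp_step_def)
  have up: "exp_step E (Suc i) (2 ^ Suc i)" if "E i (2 ^ i)" for E i
    using that by (auto simp: exp_step_def pow2_def)
  have "\<exists>j. exp_base j (2 ^ j) \<and> j \<le> i \<and> i \<le> j + 4"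
  proof (cases "i \<le> 4")
    case True
    then show ?thesis by (intro exI[of _ 0]) (simp add: exp_base_def)
  next
    case False
    \<comment> \<open>The largest odd number up to \<open>i\<close>. As \<open>5 <= j\<close>, both
      \<open>j + 1\<close> and \<open>j - 1\<close> are at least 4; if both were powers of two, both
      would be multiples of 4, yet they differ by 2. So \<open>j\<close> or \<open>j - 2\<close> is
      a base exponent.\<close>
    define j where "j = (if odd i then i else i - 1)"
    have j: "odd j" "j \<le> i" "i \<le> j + 1" "5 \<le> j" using False by (auto simp: j_def)
    have dvd: "4 dvd q" if "pow2 q" "4 \<le> q" for q
    proof -
      obtain k where k: "q = 2 ^ k" using \<open>pow2 q\<close> by (auto simp: pow2_def)
      have "2 \<le> k"
      proof (rule ccontr)
        assume "\<not> 2 \<le> k"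
        then have "k = 0 \<or> k = 1" by auto
        then show False using that k by auto
      qed
      then show ?thesis using le_imp_power_dvd[of 2 k "2::nat"] k by simp
    qed
    have "\<not> pow2 (Suc j) \<or> \<not> pow2 (Suc (j - 2))"
    proof (rule ccontr)
      assume "\<not> ?thesis"
      then have "4 dvd Suc j" "4 dvd Suc (j - 2)" using dvd j by auto
      then show False using j by presburger
    qed
    then show ?thesis
    proof
      assume "\<not> pow2 (Suc j)"
      then show ?thesis using j by (intro exI[of _ j]) (simp add: exp_base_def odd_exp_def)
    next
      assume "\<not> pow2 (Suc (j - 2))"
      then show ?thesis using j
        by (intro exI[of _ "j - 2"]) (auto simp: exp_base_def odd_exp_def)
    qed
  qed
  then obtain j where j: "exp_base j (2 ^ j)" "j \<le> i" "i \<le> j + 4" by blast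
  then have "i = j \<or> i = Suc j \<or> i = Suc (Suc j) \<or> i = Suc (Suc (Suc j)) \<or> i = Suc (Suc (Suc (Suc j)))"
    by linarith
  \<comment> \<open>Steps not spent on raising the exponent are idle, by
    \<open>keep\<close>.\<close>
  then show "exp_step (exp_step (exp_step (exp_step exp_base))) i p"
    unfolding p using j(1) keep up by metis
qed

lemma exp_step_iff:
  assumes "i \<le> n" "p \<le> n"
  shows "exp_step E i p \<longleftrightarrow> E i p \<or> (\<exists>j\<le>n. \<exists>q\<le>n. i = Suc j \<and> (p = 2 * q \<and> pow2 q) \<and> E j q)"
proof -
  have "j \<le> n" "q \<le> n" if "i = Suc j" "p = 2 * q" for j q
    using assms that by auto
  then show ?thesis unfolding exp_step_def by blast
qed

text \<open>Powers of two with \<open>q < p\<close> satisfy \<open>2 * q <= p\<close>, and the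
  condition at \<open>y = p - 1\<close> gives the converse bound.\<close>

lemma double_iff:
  assumes "p \<le> n" "q \<le> n"
  shows "p = 2 * q \<and> pow2 q \<longleftrightarrow>
    pow2 q \<and> pow2 p \<and> q < p \<and> (\<forall>y\<le>n. y < p \<longrightarrow> pow2 q \<and> y < 2 * q)"
proof
  assume *: "p = 2 * q \<and> pow2 q"
  then have "pow2 p" unfolding pow2_def by (metis power_Suc)
  moreover have "0 < q" using * by (auto simp: pow2_def)
  ultimately show "pow2 q \<and> pow2 p \<and> q < p \<and> (\<forall>y\<le>n. y < p \<longrightarrow> pow2 q \<and> y < 2 * q)"
    using * by auto
next
  assume *: "pow2 q \<and> pow2 p \<and> q < p \<and> (\<forall>y\<le>n. y < p \<longrightarrow> pow2 q \<and> y < 2 * q)"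
  then obtain k l where kl: "q = 2 ^ k" "p = 2 ^ l" by (auto simp: pow2_def)
  have "k < l" using * by (simp add: kl)
  then have "(2::nat) ^ Suc k \<le> 2 ^ l" by (intro power_increasing) auto
  then have "2 * q \<le> p" by (simp add: kl)
  moreover have "p - 1 < 2 * q" using * assms by auto
  ultimately show "p = 2 * q \<and> pow2 q" using * by auto
qed

lemma definable_bit:
  assumes less: "\<And>x y. definable N (\<lambda>n e. e x < e y)"
    and prec: "\<And>x y. definable N (\<lambda>n e. prec (e x) (e y))"
  shows "definable N (\<lambda>n e. bit (e x) (e y))"
proof -
  have Suc: "definable N (\<lambda>n e. e x = Suc (e y))" for x y
  proof (rule definable_cong2)
    show "a = Suc b \<longleftrightarrow> b < a \<and> (\<forall>c\<le>n. \<not> (b < c \<and> c < a))" if "a \<le> n" "b \<le> n" for a b n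
      using that by (metis Suc_leI Suc_lessI lessI less_le_trans linorder_not_less order_trans)
  qed (intro definable_intros less)
  have zero: "definable N (\<lambda>n e. e x = 0)" for x
  proof (rule definable_cong1)
    show "a = 0 \<longleftrightarrow> (\<forall>c\<le>n. \<not> c < a)" if "a \<le> n" for a n :: nat
      using that by auto
  qed (intro definable_intros less)
  have one: "definable N (\<lambda>n e. e x = 1)" for x
  proof (rule definable_cong1)
    show "a = 1 \<longleftrightarrow> (\<exists>c\<le>n. c = 0 \<and> a = Suc c)" if "a \<le> n" for a n :: nat
      by auto
  qed (intro definable_intros zero Suc)
  have even: "definable N (\<lambda>n e. even (e x))" for x
    by (rule definable_cong1[OF even_iff_prec]) (assumption | intro definable_intros Suc prec)+
  have pow2: "definable N (\<lambda>n e. pow2 (e x))" for x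
    by (rule definable_cong1[OF pow2_iff])
      (assumption | intro definable_intros zero one even less prec)+
  have below: "definable N (\<lambda>n e. pow2 (e x) \<and> e y < 2 * e x)" for x y
    by (rule definable_cong2[OF below_double_iff]) (assumption | intro definable_intros pow2 less)+
  \<comment> \<open>The condition \<open>y < 2 * p\<close> is available only together with
    \<open>pow2 p\<close>, so \<open>below\<close> has to apply before the conjunction is
    split.\<close>
  have bit_at: "definable N (\<lambda>n e. bit_at (e x) (e y))" for x y
    by (rule definable_cong2[OF bit_at_iff])
      (assumption | rule below one even pow2 Suc less prec definable_intros)+
  have double: "definable N (\<lambda>n e. e x = 2 * e y \<and> pow2 (e y))" for x y
    by (rule definable_cong2[OF double_iff])
      (assumption | rule below pow2 less definable_intros)+
  have odd_exp: "definable N (\<lambda>n e. odd_exp (e x) (e y))" for x y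
    by (rule definable_cong2[OF odd_exp_iff])
      (assumption | intro definable_intros even pow2 Suc prec)+
  have base: "definable N (\<lambda>n e. exp_base (e x) (e y))" for x y
    unfolding exp_base_def by (intro definable_intros zero one odd_exp)
  have step: "definable N (\<lambda>n e. exp_step E (e x) (e y))"
    if "\<And>x y. definable N (\<lambda>n e. E (e x) (e y))" for E x y
    by (rule definable_cong2[OF exp_step_iff])
      (assumption | rule double Suc that definable_intros)+
  have exp: "definable N (\<lambda>n e. e x = 2 ^ e y)" for x y
    unfolding exp_iff by (intro step base)
  show ?thesis
  proof (rule definable_cong2)
    show "bit a i \<longleftrightarrow> (\<exists>p\<le>n. p = 2 ^ i \<and> bit_at a p)" if "a \<le> n" "i \<le> n" for a i n :: nat
    proof -
      \<comment> \<open>A set bit \<open>i\<close> gives \<open>2 ^ i <= a\<close>, so the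
        intermediate power lies in the universe.\<close>
      have "2 ^ i \<le> n" if "bit a i"
        using that \<open>a \<le> n\<close> by (metis bit_iff_odd div_less even_zero linorder_not_less order_trans)
      then show ?thesis by (auto simp: bit_at_def)
    qed
  qed (intro definable_intros exp bit_at)
qed

theorem theorem5p2:
  shows "\<exists>r :: (nat \<times> nat) set. strict_linear_order r \<and>
           same_expressive_power (less_and r) (\<lambda>_ :: unit. Bit)"
proof (intro exI conjI)
  let ?r = "{(a, b). prec a b}"
  let ?N = "less_and ?r" and ?B = "\<lambda>_ :: unit. Bit"
  show "strict_linear_order ?r" by (rule strict_linear_order_prec)
  have Bit: "Bit = {[a, b] | a b. bit a b}"
    by (simp add: Bit_def bit_iff_odd)
  have N: "?N P = {[a, b] | a b. if P then a < b else prec a b}" for P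
    by (simp add: less_and_def less_pred_def rel_pred_def)
  have bit: "definable ?B (\<lambda>n e. bit (e x) (e y))" for x y
    using definable_Num[of ?B "[x, y]" "()"] unfolding Bit by simp
  have less: "definable ?N (\<lambda>n e. e x < e y)" for x y
    using definable_Num[of ?N "[x, y]" True] unfolding N by simp
  have prec: "definable ?N (\<lambda>n e. prec (e x) (e y))" for x y
    using definable_Num[of ?N "[x, y]" False] unfolding N by simp
  have "definable ?B (\<lambda>n e. map e xs \<in> ?N P)" for P xs
    unfolding N
    by (rule definable_binary_atom) (cases P; simp add: definable_less[OF bit] definable_prec[OF bit])
  then have *: "\<exists>\<psi> :: (nat, unit) fo. fo_equiv ?N \<phi> ?B \<psi>" for \<phi> :: "(nat, bool) fo"
    by (rule translate_formula)
  have "definable ?N (\<lambda>n e. map e xs \<in> ?B P)" for P xs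
    unfolding Bit by (rule definable_binary_atom) (rule definable_bit[OF less prec])
  then have "\<exists>\<phi> :: (nat, bool) fo. fo_equiv ?B \<psi> ?N \<phi>" for \<psi> :: "(nat, unit) fo"
    by (rule translate_formula)
  then have "\<exists>\<phi> :: (nat, bool) fo. fo_equiv ?N \<phi> ?B \<psi>" for \<psi> :: "(nat, unit) fo"
    unfolding fo_equiv_def by metis
  with * show "same_expressive_power ?N ?B"
    unfolding same_expressive_power_def by blast
qed

end
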